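(* Let $m\ge0$, $\zeta\in\mathbb R$, $b\in\mathbb R^4$, let $\phi_{\mu\nu}$ be a real antisymmetric tensor, $\varpi=-i\phi$, and let $\Lambda=\exp(i\varpi)=\exp(\phi)$ be the Lorentz transformation generated by the matrix $\phi^\mu{}_\nu$. For $n\ge1$ put $\tilde b(-n\varpi)=\sum_{k\ge0}\frac{(-in\varpi)^k}{(k+1)!}b$. Let $$\langle \hat a^\dagger(p)\hat a(p')\rangle=2\varepsilon'\sum_{n=1}^\infty\delta^3(\Lambda^n\mathbf p-\mathbf p')\,\exp[-n\,\tilde b(-n\varpi)\cdot p+n\zeta],$$ and define the complex phase space distribution function $$f_c(x,p)=\frac1{(2\pi)^3}\int\frac{d^3p'}{2\varepsilon'}\,e^{i(p-p')\cdot x}\,\langle \hat a^\dagger(p)\hat a(p')\rangle$$ (integrated term by term). Then for all $x\in\mathbb R^4$ and all $p$ on the mass shell $$f_c(x,p)=\frac{1}{(2\pi)^3}\sum_{n=1}^\infty\exp\big[-n\,\tilde\beta(-n\varpi)\cdot p+n\zeta\big],$$ the equality holding term by term, where $$\beta^\mu=b^\mu+\varpi^\mu{}_\nu x^\nu,\qquad \tilde\beta(-n\varpi)=\sum_{k=0}^\infty\frac{(-in\varpi)^k}{(k+1)!}\,\beta .$$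
   Context: The metric is $\mathrm{diag}(1,-1,-1,-1)$ and the dot is the (complex bilinear) Minkowski product; tensors act as matrices, $(\varpi v)^\mu=\varpi^\mu{}_\nu v^\nu$. The mass shell consists of $p=(\varepsilon,\mathbf p)$ with $\varepsilon=\sqrt{\mathbf p^2+m^2}$; $\Lambda\mathbf p$ is the spatial part of $\Lambda p$. The distribution $2\varepsilon'\delta^3(\Lambda^n\mathbf p-\mathbf p')$ satisfies $\int\frac{d^3p'}{2\varepsilon'}\,2\varepsilon'\delta^3(\Lambda^n\mathbf p-\mathbf p')h(p')=h(\Lambda^np)$. *)

theory Defs
  imports "HOL-Analysis.Analysis"
begin

text \<open>
  Four-vectors are elements of \<open>'a ^ 4\<close> whose time component has index \<open>0 :: 4\<close> and whose
  spatial components have the indices 1, 2, 3.  Three-vectors are elements of \<open>real ^ 3\<close> with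
  indices 1, 2, 3.
\<close>

definition metric :: "'a::comm_ring_1 ^ 4 ^ 4" where
  "metric = (\<chi> \<mu> \<nu>. if \<mu> = \<nu> then (if \<mu> = 0 then 1 else - 1) else 0)"

text \<open>Over \<^typ>\<open>complex\<close> this is the bilinear (not sesquilinear) product.\<close>

definition mdot :: "'a::comm_ring_1 ^ 4 \<Rightarrow> 'a ^ 4 \<Rightarrow> 'a"  (infixl \<open>\<bullet>\<^sub>M\<close> 70) where
  "u \<bullet>\<^sub>M v = (\<Sum>\<mu>\<in>UNIV. \<Sum>\<nu>\<in>UNIV. metric $ \<mu> $ \<nu> * u $ \<mu> * v $ \<nu>)"

definition cvec :: "real ^ 'n \<Rightarrow> complex ^ 'n" where
  "cvec v = (\<chi> \<mu>. complex_of_real (v $ \<mu>))"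

text \<open>
  Powers and the exponential refer to the matrix product \<open>**\<close>; the library's \<open>*\<close> and \<open>^\<close>
  act componentwise on \<open>'a ^ 'n ^ 'n\<close>.
\<close>

primrec matpow :: "'a::semiring_1 ^ 'n ^ 'n \<Rightarrow> nat \<Rightarrow> 'a ^ 'n ^ 'n" where
  "matpow A 0 = mat 1"
| "matpow A (Suc k) = A ** matpow A k"

definition matexp :: "'a::real_normed_field ^ 'n ^ 'n \<Rightarrow> 'a ^ 'n ^ 'n" where
  "matexp A = (\<Sum>k. (1 / fact k) *\<^sub>R matpow A k)"

text \<open>
  A tensor with two lower indices is given by its matrix of components \<open>\<phi>\<^sub>\<mu>\<^sub>\<nu>\<close>; \<open>mixed \<phi>\<close>
  has the first index raised.  Since the metric is its own inverse, \<open>metric\<close> also serves as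
  \<open>g\<^sup>\<mu>\<^sup>\<nu>\<close>.
\<close>

definition mixed :: "real ^ 4 ^ 4 \<Rightarrow> real ^ 4 ^ 4" where
  "mixed \<phi> = metric ** \<phi>"

text \<open>The mixed components \<open>\<varpi>\<^sup>\<mu>\<^sub>\<nu>\<close> of \<open>\<varpi> = -i\<phi>\<close>.\<close>

definition varpi :: "real ^ 4 ^ 4 \<Rightarrow> complex ^ 4 ^ 4" where
  "varpi \<phi> = map_matrix (\<lambda>r. - \<i> * complex_of_real r) (mixed \<phi>)"

definition Lorentz :: "real ^ 4 ^ 4 \<Rightarrow> real ^ 4 ^ 4" where
  "Lorentz \<phi> = matexp (mixed \<phi>)"

lemma i_varpi: "map_matrix (\<lambda>z. \<i> * z) (varpi \<phi>) = map_matrix complex_of_real (mixed \<phi>)"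
  by (simp add: varpi_def map_matrix_def)

text \<open>
  \<open>tilde v A\<close> is \<open>\<Sum>\<^sub>k (iA)\<^sup>k / (k+1)! v\<close>, so that \<open>tilde b (-n\<varpi>)\<close> is the series
  \<open>\<Sum>\<^sub>k (-in\<varpi>)\<^sup>k / (k+1)! b\<close>.
\<close>

definition tilde :: "complex ^ 4 \<Rightarrow> complex ^ 4 ^ 4 \<Rightarrow> complex ^ 4" where
  "tilde v A = (\<Sum>k. (1 / fact (k + 1)) *\<^sub>R (matpow (map_matrix (\<lambda>z. \<i> * z) A) k *v v))"

definition spatial :: "real ^ 4 \<Rightarrow> real ^ 3" where
  "spatial p = vector [p $ 1, p $ 2, p $ 3]"

definition energy :: "real \<Rightarrow> real ^ 3 \<Rightarrow> real" where
  "energy m q = sqrt ((norm q)\<^sup>2 + m\<^sup>2)"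

definition on_shell :: "real \<Rightarrow> real ^ 3 \<Rightarrow> real ^ 4" where
  "on_shell m q = (\<chi> \<mu>. if \<mu> = 0 then energy m q
      else if \<mu> = 1 then q $ 1 else if \<mu> = 2 then q $ 2 else q $ 3)"

definition mass_shell :: "real \<Rightarrow> (real ^ 4) set" where
  "mass_shell m = range (on_shell m)"

text \<open>
  A distribution \<open>F(p')\<close> in the three-momentum \<open>p'\<close> is represented by the functional
  \<open>h \<mapsto> \<integral> d\<^sup>3p' / (2\<epsilon>') F(p') h(p')\<close>.  Integration against the Lorentz invariant measure
  is therefore application of the functional, and \<open>2\<epsilon>' \<delta>\<^sup>3(q - p')\<close> is evaluation at \<open>q\<close>.
  Pairing with the invariant measure makes the factors \<open>2\<epsilon>'\<close> cancel identically, also at the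
  tip of the cone (\<open>m = 0\<close>, \<open>q = 0\<close>), where \<open>\<epsilon>'\<close> vanishes.
\<close>

type_synonym shell_distribution = "(real ^ 3 \<Rightarrow> complex) \<Rightarrow> complex"

definition shell_delta :: "real ^ 3 \<Rightarrow> shell_distribution" where
  "shell_delta q = (\<lambda>h. h q)"

text \<open>
  The \<open>n\<close>-th term (\<open>n \<ge> 1\<close>) of \<open>\<langle>a\<^sup>\<dagger>(p) a(p')\<rangle>\<close> as a distribution in \<open>p'\<close>.  The expectation
  value is the formal series of these terms: no convergence is presupposed, and \<open>f_c\<close> is
  obtained by integrating each term separately.
\<close>

definition corr_term ::
    "real ^ 4 ^ 4 \<Rightarrow> real ^ 4 \<Rightarrow> real \<Rightarrow> real ^ 4 \<Rightarrow> nat \<Rightarrow> shell_distribution" where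
  "corr_term \<phi> b \<zeta> p n = (\<lambda>h.
     exp (- of_nat n * (tilde (cvec b) (- real n *\<^sub>R varpi \<phi>) \<bullet>\<^sub>M cvec p)
            + of_nat n * complex_of_real \<zeta>)
     * shell_delta (spatial (matpow (Lorentz \<phi>) n *v p)) h)"

definition f_c_term ::
    "real \<Rightarrow> real ^ 4 ^ 4 \<Rightarrow> real ^ 4 \<Rightarrow> real \<Rightarrow> real ^ 4 \<Rightarrow> real ^ 4 \<Rightarrow> nat \<Rightarrow> complex" where
  "f_c_term m \<phi> b \<zeta> x p n =
     corr_term \<phi> b \<zeta> p n (\<lambda>p'. exp (\<i> * complex_of_real ((p - on_shell m p') \<bullet>\<^sub>M x)))"

definition f_c ::
    "real \<Rightarrow> real ^ 4 ^ 4 \<Rightarrow> real ^ 4 \<Rightarrow> real \<Rightarrow> real ^ 4 \<Rightarrow> real ^ 4 \<Rightarrow> complex" where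
  "f_c m \<phi> b \<zeta> x p = 1 / (2 * pi) ^ 3 * (\<Sum>n. f_c_term m \<phi> b \<zeta> x p (Suc n))"

definition beta :: "real ^ 4 ^ 4 \<Rightarrow> real ^ 4 \<Rightarrow> real ^ 4 \<Rightarrow> complex ^ 4" where
  "beta \<phi> b x = cvec b + varpi \<phi> *v cvec x"

end

theory Submission
  imports Defs
begin

text \<open>
  Write \<open>B = \<phi>\<close> for the mixed tensor, so that \<open>-in\<varpi> = -nB\<close> and the part of
  \<open>n \<beta>\<tilde>(-n\<varpi>)\<close> linear in \<open>x\<close> is \<open>-i \<Sum>\<^sub>k n (-nB)\<^sup>k/(k+1)! Bx = i (exp(-nB) x - x)\<close>.
  As \<open>B\<close> is antisymmetric for the Minkowski product, its product with \<open>p\<close> is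
  \<open>i (x \<cdot> \<Lambda>\<^sup>n p - x \<cdot> p)\<close>, which is minus the phase \<open>i (p - p') \<cdot> x\<close> at \<open>p' = \<Lambda>\<^sup>n p\<close>.  It remains
  to see that \<open>\<Lambda>\<^sup>n p\<close> is the on-shell vector over its spatial part: \<open>exp(tB)\<close> preserves the
  Minkowski square, and the energy of \<open>exp(tB) p\<close> cannot change sign along \<open>t\<close>, since an
  on-shell vector of energy zero vanishes.
\<close>

section \<open>Matrix powers and convergence of the matrix exponential\<close>

lemma matpow_commute: "matpow A k ** A = A ** matpow A k"
  by (induction k) (simp_all add: matrix_mul_assoc[symmetric])

lemma scaleR_matrix_mult [simp]:
  "(c *\<^sub>R A) ** B = c *\<^sub>R (A ** (B :: real ^ 'k ^ 'n))"
  "A ** (c *\<^sub>R B) = c *\<^sub>R (A ** B)"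
  by (simp_all add: vec_eq_iff matrix_matrix_mult_def sum_distrib_left mult_ac)

lemma matpow_scaleR: "matpow (c *\<^sub>R A) k = c ^ k *\<^sub>R matpow (A :: real ^ 'n ^ 'n) k"
  by (induction k) simp_all

lemma bounded_linear_matrix_mult_right:
  "bounded_linear (\<lambda>X. (A :: real ^ 'n ^ 'm) ** (X :: real ^ 'k ^ 'n))"
  by (intro linear_conv_bounded_linear[THEN iffD1] linearI) (auto simp: matrix_add_ldistrib)

lemma bounded_linear_matrix_mult_left:
  "bounded_linear (\<lambda>X. (X :: real ^ 'n ^ 'm) ** (A :: real ^ 'k ^ 'n))"
  by (intro linear_conv_bounded_linear[THEN iffD1] linearI)
    (auto simp: vec_eq_iff matrix_matrix_mult_def distrib_right sum.distrib sum_distrib_left mult.assoc)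

lemma uminus_matrix_vector: "(- (A :: real ^ 'n ^ 'm)) *v v = - (A *v v)"
  by (simp add: vec_eq_iff matrix_vector_mult_def sum_negf)

lemma bounded_linear_matrix_vector: "bounded_linear (\<lambda>X. (X :: real ^ 'n ^ 'm) *v v)"
  by (intro linear_conv_bounded_linear[THEN iffD1] linearI)
    (auto simp: matrix_vector_mult_add_rdistrib scaleR_matrix_vector_assoc)

text \<open>Multiplication by \<open>A\<close> is a bounded linear map, so powers of
  \<open>A\<close> grow at most geometrically and the scalar exponential series dominates.\<close>

lemma summable_norm_matexp:
  "summable (\<lambda>k. norm ((1 / fact k) *\<^sub>R matpow (A :: real ^ 'n ^ 'n) k))"
proof -
  obtain K where K: "K > 0" "\<And>X :: real ^ 'n ^ 'n. norm (A ** X) \<le> norm X * K"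
    using bounded_linear.pos_bounded[OF bounded_linear_matrix_mult_right] by blast
  have bound: "norm (matpow A k) \<le> K ^ k * norm (mat 1 :: real ^ 'n ^ 'n)" for k
  proof (induction k)
    case (Suc k)
    have "norm (matpow A (Suc k)) \<le> norm (matpow A k) * K" using K(2) by simp
    also have "\<dots> \<le> (K ^ k * norm (mat 1 :: real ^ 'n ^ 'n)) * K"
      using Suc K(1) by (intro mult_right_mono) auto
    finally show ?case by (simp add: mult_ac)
  qed simp
  have "summable (\<lambda>k. (inverse (fact k) * K ^ k) * norm (mat 1 :: real ^ 'n ^ 'n))"
    by (intro summable_mult2 summable_exp)
  then show ?thesis
  proof (rule summable_comparison_test'[where N = 0])
    fix k :: nat
    have "inverse (fact k) * norm (matpow A k)
        \<le> inverse (fact k) * (K ^ k * norm (mat 1 :: real ^ 'n ^ 'n))"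
      by (intro mult_left_mono bound) auto
    then show "norm (norm ((1 / fact k) *\<^sub>R matpow A k))
        \<le> (inverse (fact k) * K ^ k) * norm (mat 1 :: real ^ 'n ^ 'n)"
      by (simp add: field_simps)
  qed
qed

lemma matexp_sums: "(\<lambda>k. (1 / fact k) *\<^sub>R matpow A k) sums matexp (A :: real ^ 'n ^ 'n)"
  unfolding matexp_def by (rule summable_sums[OF summable_norm_cancel[OF summable_norm_matexp]])

lemma matexp_vector_sums:
  "(\<lambda>k. (1 / fact k) *\<^sub>R (matpow A k *v v)) sums (matexp (A :: real ^ 'n ^ 'n) *v v)"
  using bounded_linear.sums[OF bounded_linear_matrix_vector matexp_sums]
  by (simp add: scaleR_matrix_vector_assoc)

lemma matexp_0: "matexp (0 :: real ^ 'n ^ 'n) = mat 1"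
proof -
  have "matpow (0 :: real ^ 'n ^ 'n) k = 0" if "k \<noteq> 0" for k
    using that by (cases k) auto
  then have "(\<lambda>k. (1 / fact k) *\<^sub>R matpow (0 :: real ^ 'n ^ 'n) k) sums
      (\<Sum>k\<in>{0}. (1 / fact k) *\<^sub>R matpow (0 :: real ^ 'n ^ 'n) k)"
    by (intro sums_finite) auto
  then show ?thesis using sums_unique2[OF matexp_sums] by fastforce
qed

lemma matexp_commute: "matexp A ** A = A ** matexp (A :: real ^ 'n ^ 'n)"
proof -
  have "(\<lambda>k. ((1 / fact k) *\<^sub>R matpow A k) ** A) sums (matexp A ** A)"
    by (rule bounded_linear.sums[OF bounded_linear_matrix_mult_left matexp_sums])
  moreover have "(\<lambda>k. A ** ((1 / fact k) *\<^sub>R matpow A k)) sums (A ** matexp A)"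
    by (rule bounded_linear.sums[OF bounded_linear_matrix_mult_right matexp_sums])
  moreover have "((1 / fact k) *\<^sub>R matpow A k) ** A = A ** ((1 / fact k) *\<^sub>R matpow A k)" for k
    by (simp add: matpow_commute)
  ultimately show ?thesis by (simp add: sums_unique2)
qed

section \<open>Differentiation in the parameter and the one-parameter group law\<close>

lemma matexp_entry_sums:
  "(\<lambda>k. (matpow A k $ i $ j / fact k) * t ^ k) sums (matexp (t *\<^sub>R (A :: real ^ 'n ^ 'n)) $ i $ j)"
proof -
  have "(\<lambda>k. ((1 / fact k) *\<^sub>R matpow (t *\<^sub>R A) k) $ i $ j) sums (matexp (t *\<^sub>R A) $ i $ j)"
    by (intro bounded_linear.sums[OF bounded_linear_vec_nth] matexp_sums)
  then show ?thesis by (simp add: matpow_scaleR mult_ac)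
qed

text \<open>Each entry is an everywhere convergent power series in \<open>t\<close>, so it may be
  differentiated termwise; the factor \<open>k + 1\<close> in \<open>diffs\<close> reduces
  \<open>(k + 1)!\<close> to \<open>k!\<close> and leaves one extra factor \<open>A\<close>.\<close>

lemma DERIV_matexp:
  "((\<lambda>t. matexp (t *\<^sub>R (A :: real ^ 'n ^ 'n)) $ i $ j) has_real_derivative
     (A ** matexp (t *\<^sub>R A)) $ i $ j) (at t)"
proof -
  define c where "c k = matpow A k $ i $ j / fact k" for k
  have E: "matexp (t *\<^sub>R A) $ i $ j = (\<Sum>k. c k * t ^ k)" for t
    using matexp_entry_sums[of A i j t] by (simp add: c_def sums_iff)
  have D: "((\<lambda>t. \<Sum>k. c k * t ^ k) has_real_derivative (\<Sum>k. diffs c k * t ^ k)) (at t)"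
    using matexp_entry_sums[of A i j] unfolding c_def
    by (intro termdiffs_strong_converges_everywhere) (simp add: sums_iff)
  have "(\<lambda>k. (A ** ((1 / fact k) *\<^sub>R matpow (t *\<^sub>R A) k)) $ i $ j) sums (A ** matexp (t *\<^sub>R A)) $ i $ j"
    by (intro bounded_linear.sums[OF bounded_linear_vec_nth]
        bounded_linear.sums[OF bounded_linear_matrix_mult_right] matexp_sums)
  moreover have "(A ** ((1 / fact k) *\<^sub>R matpow (t *\<^sub>R A) k)) $ i $ j = diffs c k * t ^ k" for k
  proof -
    have "(A ** ((1 / fact k) *\<^sub>R matpow (t *\<^sub>R A) k)) $ i $ j
        = t ^ k / fact k * (A ** matpow A k) $ i $ j"
      by (simp add: matpow_scaleR matrix_matrix_mult_def sum_distrib_left mult_ac)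
    also have "\<dots> = diffs c k * t ^ k"
      by (simp add: diffs_def c_def field_simps del: of_nat_Suc)
    finally show ?thesis .
  qed
  ultimately show ?thesis using D by (simp add: E sums_iff)
qed

text \<open>\<open>E(s + t) E(-t)\<close> has derivative \<open>E(s + t) A E(-t) - E(s + t) A E(-t) = 0\<close> in \<open>t\<close>.\<close>

lemma matexp_add_mult_minus:
  fixes A :: "real ^ 'n ^ 'n"
  shows "matexp ((s + t) *\<^sub>R A) ** matexp ((- t) *\<^sub>R A) = matexp (s *\<^sub>R A)"
proof -
  define E where "E t = matexp (t *\<^sub>R A)" for t
  have comm: "A ** E t = E t ** A" for t
  \<comment> \<open>\<open>matexp_commute\<close> at \<open>t A\<close> yields the claim only after
    cancelling \<open>t\<close>; at zero the exponential is the identity.\<close>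
  proof (cases "t = 0")
    case False
    have "t *\<^sub>R (A ** E t) = t *\<^sub>R (E t ** A)"
      using matexp_commute[of "t *\<^sub>R A"] by (auto simp: E_def)
    with False show ?thesis by simp
  qed (simp add: E_def matexp_0)
  have "(E (s + t) ** E (- t)) $ i $ j = (E (s + 0) ** E (- 0)) $ i $ j" for i j
  proof -
    have "((\<lambda>t. (E (s + t) ** E (- t)) $ i $ j) has_real_derivative 0) (at t)" for t
    proof -
      have D: "((\<lambda>t. E t $ i $ j) has_real_derivative (A ** E t) $ i $ j) (at t)" for i j t
        unfolding E_def by (rule DERIV_matexp)
      have D1: "((\<lambda>t. E (s + t) $ i $ l) has_real_derivative (E (s + t) ** A) $ i $ l) (at t)" for l
        using DERIV_shift[THEN iffD1, OF D[of i l "t + s"]] by (simp add: comm add.commute)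
      have D2: "((\<lambda>t. E (- t) $ l $ j) has_real_derivative - (A ** E (- t)) $ l $ j) (at t)" for l
        using DERIV_mirror[THEN iffD1, OF D[of l j "- t"]] by simp
      have "((\<lambda>t. \<Sum>l\<in>UNIV. E (s + t) $ i $ l * E (- t) $ l $ j) has_real_derivative
          (\<Sum>l\<in>UNIV. E (s + t) $ i $ l * - (A ** E (- t)) $ l $ j
             + (E (s + t) ** A) $ i $ l * E (- t) $ l $ j)) (at t)"
        by (intro DERIV_sum DERIV_mult' D1 D2)
      moreover have "(\<Sum>l\<in>UNIV. E (s + t) $ i $ l * - (A ** E (- t)) $ l $ j
             + (E (s + t) ** A) $ i $ l * E (- t) $ l $ j)
          = ((E (s + t) ** A) ** E (- t)) $ i $ j - (E (s + t) ** (A ** E (- t))) $ i $ j"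
        unfolding matrix_matrix_mult_def[of "E (s + t)" "A ** E (- t)"]
          matrix_matrix_mult_def[of "E (s + t) ** A" "E (- t)"]
        by (simp add: sum_subtractf)
      ultimately show ?thesis by (simp add: matrix_mul_assoc) (simp add: matrix_matrix_mult_def)
    qed
    then show ?thesis by (intro DERIV_isconst_all) auto
  qed
  then show ?thesis by (simp add: vec_eq_iff E_def matexp_0)
qed

lemma matexp_minus_mult: "matexp (- A) ** matexp (A :: real ^ 'n ^ 'n) = mat 1"
  \<comment> \<open>The case \<open>s = 0\<close>, \<open>t = -1\<close> is the inverse
    relation.\<close>
  using matexp_add_mult_minus[of 1 "- 1" A] matexp_add_mult_minus[of 0 "- 1" A]
  by (simp add: matexp_0)

lemma matexp_scaleR_add:
  "matexp ((s + t) *\<^sub>R A) = matexp (s *\<^sub>R A) ** matexp (t *\<^sub>R (A :: real ^ 'n ^ 'n))"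
  using matexp_add_mult_minus[of "s + t" "- t" A] by simp

text \<open>Places the discrete powers of \<Lambda> on the continuous path \<open>exp(tB)\<close>,
  where a connectedness argument is available.\<close>

lemma matpow_matexp: "matpow (matexp A) n = matexp (real n *\<^sub>R (A :: real ^ 'n ^ 'n))"
  by (induction n) (simp_all add: matexp_0 matexp_scaleR_add[of 1, simplified, symmetric])

section \<open>The Minkowski product and antisymmetric generators\<close>

lemma metric_symmetric: "transpose metric = metric"
  by (auto simp: transpose_def metric_def vec_eq_iff)

lemma metric_involution: "metric ** metric = (mat 1 :: real ^ 4 ^ 4)"
proof -
  have "metric $ i $ k * metric $ k $ j = (if k = i then mat 1 $ i $ j else (0 :: real))" for i j k :: 4
    by (simp add: metric_def mat_def)
  then show ?thesis by (simp add: vec_eq_iff matrix_matrix_mult_def)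
qed

lemma mdot_real: "u \<bullet>\<^sub>M v = u \<bullet> (metric *v (v :: real ^ 4))"
  by (simp add: mdot_def inner_vec_def matrix_vector_mult_def sum_distrib_left mult_ac)

lemma mdot_commute: "u \<bullet>\<^sub>M v = v \<bullet>\<^sub>M (u :: real ^ 4)"
  by (metis dot_lmul_matrix inner_commute mdot_real metric_symmetric transpose_matrix_vector)

lemma mdot_coords:
  "(u :: real ^ 4) \<bullet>\<^sub>M v = u $ 0 * v $ 0 - u $ 1 * v $ 1 - u $ 2 * v $ 2 - u $ 3 * v $ 3"
proof -
  \<comment> \<open>Indices are taken modulo 4, so the last summand of \<open>sum_4\<close> is the
    time component.\<close>
  have "(4 :: 4) = 0" by simp
  then show ?thesis by (simp only: mdot_def metric_def sum_4) simp
qed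

lemma mdot_cvec: "cvec u \<bullet>\<^sub>M cvec v = complex_of_real (u \<bullet>\<^sub>M v)"
  by (auto simp: mdot_def cvec_def metric_def intro!: sum.cong)

text \<open>The metric in the product lowers the index that \<open>mixed\<close> raised, leaving the
  antisymmetric matrix \<phi> in a Euclidean product.\<close>

lemma mdot_mixed:
  assumes "transpose \<phi> = - \<phi>"
  shows "(mixed \<phi> *v u) \<bullet>\<^sub>M v = - (u \<bullet>\<^sub>M (mixed \<phi> *v v))"
proof -
  have G: "metric *v (mixed \<phi> *v w) = \<phi> *v w" for w
    by (simp add: mixed_def matrix_vector_mul_assoc matrix_mul_assoc metric_involution)
  have "(mixed \<phi> *v u) \<bullet>\<^sub>M v = v \<bullet> (\<phi> *v u)"
    by (subst mdot_commute) (simp add: mdot_real G)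
  also have "\<dots> = (transpose \<phi> *v v) \<bullet> u"
    by (simp add: dot_lmul_matrix)
  also have "\<dots> = - (u \<bullet>\<^sub>M (mixed \<phi> *v v))"
    using assms by (simp add: mdot_real G inner_commute uminus_matrix_vector)
  finally show ?thesis .
qed

lemma mdot_scaleR [simp]:
  "(c *\<^sub>R u) \<bullet>\<^sub>M v = c * (u \<bullet>\<^sub>M (v :: real ^ 4))"
  "u \<bullet>\<^sub>M (c *\<^sub>R v) = c * (u \<bullet>\<^sub>M (v :: real ^ 4))"
  by (simp_all add: mdot_coords algebra_simps)

lemma bounded_linear_mdot_right: "bounded_linear (\<lambda>v. (u :: real ^ 4) \<bullet>\<^sub>M v)"
  by (intro linear_conv_bounded_linear[THEN iffD1] linearI)
    (simp_all add: mdot_coords algebra_simps)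

text \<open>The Minkowski adjoint of \<open>A\<close> is \<open>- A\<close>, hence that of each
  power of \<open>A\<close> is the same power of \<open>- A\<close>; continuity of the product
  carries this to the series.\<close>

lemma mdot_matexp_minus:
  fixes A :: "real ^ 4 ^ 4"
  assumes "\<And>u v. (A *v u) \<bullet>\<^sub>M v = - (u \<bullet>\<^sub>M (A *v v))"
  shows "(matexp (- A) *v u) \<bullet>\<^sub>M v = u \<bullet>\<^sub>M (matexp A *v v)"
proof -
  have minus: "((- A) *v u) \<bullet>\<^sub>M v = u \<bullet>\<^sub>M (A *v v)" for u v
    using assms[of u v] by (simp add: mdot_real uminus_matrix_vector)
  have pow: "(matpow (- A) k *v u) \<bullet>\<^sub>M v = u \<bullet>\<^sub>M (matpow A k *v v)" for k
  proof (induction k arbitrary: v)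
    case (Suc k)
    have "(matpow (- A) (Suc k) *v u) \<bullet>\<^sub>M v = (matpow (- A) k *v u) \<bullet>\<^sub>M (A *v v)"
      by (simp add: minus flip: matrix_vector_mul_assoc)
    also have "\<dots> = u \<bullet>\<^sub>M ((matpow A k ** A) *v v)"
      by (simp add: Suc matrix_vector_mul_assoc)
    finally show ?case by (simp add: matpow_commute)
  qed simp
  \<comment> \<open>The factors are swapped because continuity was established in the right
    argument.\<close>
  have "(\<lambda>k. v \<bullet>\<^sub>M ((1 / fact k) *\<^sub>R (matpow (- A) k *v u))) sums (v \<bullet>\<^sub>M (matexp (- A) *v u))"
    by (rule bounded_linear.sums[OF bounded_linear_mdot_right matexp_vector_sums])
  moreover have "(\<lambda>k. u \<bullet>\<^sub>M ((1 / fact k) *\<^sub>R (matpow A k *v v))) sums (u \<bullet>\<^sub>M (matexp A *v v))"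
    by (rule bounded_linear.sums[OF bounded_linear_mdot_right matexp_vector_sums])
  moreover have "v \<bullet>\<^sub>M ((1 / fact k) *\<^sub>R (matpow (- A) k *v u)) = u \<bullet>\<^sub>M ((1 / fact k) *\<^sub>R (matpow A k *v v))" for k
    using pow[of k] by (simp add: mdot_commute[of v])
  ultimately show ?thesis by (simp add: sums_unique2 mdot_commute[of v])
qed

lemma matexp_mixed_minus:
  assumes "transpose \<phi> = - \<phi>"
  shows "(matexp ((- t) *\<^sub>R mixed \<phi>) *v u) \<bullet>\<^sub>M v = u \<bullet>\<^sub>M (matexp (t *\<^sub>R mixed \<phi>) *v v)"
proof -
  have "((t *\<^sub>R mixed \<phi>) *v u) \<bullet>\<^sub>M v = - (u \<bullet>\<^sub>M ((t *\<^sub>R mixed \<phi>) *v v))" for u v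
    using mdot_mixed[OF assms, of u v]
    by (simp flip: scaleR_matrix_vector_assoc)
  then show ?thesis using mdot_matexp_minus[of "t *\<^sub>R mixed \<phi>" u v] by simp
qed

text \<open>Moving one exponential across the product reverses the sign of \<open>t\<close>, and the
  two then cancel.\<close>

lemma mdot_matexp_mixed:
  assumes "transpose \<phi> = - \<phi>"
  shows "(matexp (t *\<^sub>R mixed \<phi>) *v u) \<bullet>\<^sub>M (matexp (t *\<^sub>R mixed \<phi>) *v v) = u \<bullet>\<^sub>M v"
  using matexp_minus_mult[of "t *\<^sub>R mixed \<phi>"]
  by (simp add: matrix_vector_mul_assoc flip: matexp_mixed_minus[OF assms])

section \<open>The mass shell and its invariance\<close>

lemma on_shell_coords:
  "on_shell m q $ 0 = energy m q" "on_shell m q $ 1 = q $ 1"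
  "on_shell m q $ 2 = q $ 2" "on_shell m q $ 3 = q $ 3"
  by (simp_all add: on_shell_def)

lemma norm_spatial: "(norm (spatial q))\<^sup>2 = (q $ 1)\<^sup>2 + (q $ 2)\<^sup>2 + (q $ 3)\<^sup>2"
  unfolding power2_norm_eq_inner inner_vec_def by (simp add: spatial_def sum_3 power2_eq_square)

lemma vec4_eqI:
  fixes u v :: "'a ^ 4"
  assumes "u $ 0 = v $ 0" "u $ 1 = v $ 1" "u $ 2 = v $ 2" "u $ 3 = v $ 3"
  shows "u = v"
proof -
  have "(4 :: 4) = 0" by simp
  then have "u $ i = v $ i" for i
    using exhaust_4[of i] assms by metis
  then show ?thesis by (simp add: vec_eq_iff)
qed

lemma on_shell_spatial:
  assumes "q \<bullet>\<^sub>M q = m\<^sup>2" and "q $ 0 \<ge> 0"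
  shows "on_shell m (spatial q) = q"
proof (rule vec4_eqI)
  have "(norm (spatial q))\<^sup>2 + m\<^sup>2 = (q $ 0)\<^sup>2"
    using assms(1) unfolding norm_spatial mdot_coords by (simp add: power2_eq_square)
  then show "on_shell m (spatial q) $ 0 = q $ 0"
    using assms(2) by (simp add: on_shell_coords energy_def)
qed (simp_all add: on_shell_coords spatial_def)

text \<open>Trades the parametrisation by three-momenta for a Lorentz invariant square and a sign,
  which can be followed separately along \<open>exp(tB)\<close>.\<close>

lemma mass_shell_iff: "p \<in> mass_shell m \<longleftrightarrow> p \<bullet>\<^sub>M p = m\<^sup>2 \<and> p $ 0 \<ge> 0"
proof
  assume "p \<in> mass_shell m"
  then obtain q where p: "p = on_shell m q" by (auto simp: mass_shell_def)
  have "(norm q)\<^sup>2 = q $ 1 * q $ 1 + q $ 2 * q $ 2 + q $ 3 * q $ 3"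
    unfolding power2_norm_eq_inner inner_vec_def by (simp add: sum_3)
  then show "p \<bullet>\<^sub>M p = m\<^sup>2 \<and> p $ 0 \<ge> 0"
    by (simp add: p mdot_coords on_shell_coords energy_def)
next
  assume "p \<bullet>\<^sub>M p = m\<^sup>2 \<and> p $ 0 \<ge> 0"
  then have "p = on_shell m (spatial p)" by (simp add: on_shell_spatial)
  then show "p \<in> mass_shell m" unfolding mass_shell_def by blast
qed

lemma matexp_mixed_mass_shell:
  assumes \<phi>: "transpose \<phi> = - \<phi>" and p: "p \<in> mass_shell m"
  shows "matexp (t *\<^sub>R mixed \<phi>) *v p \<in> mass_shell m"
proof (rule ccontr)
  define q where "q t = matexp (t *\<^sub>R mixed \<phi>) *v p" for t
  assume "\<not> ?thesis"
  have sq: "q t \<bullet>\<^sub>M q t = m\<^sup>2" for t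
    using p by (simp add: q_def mdot_matexp_mixed[OF \<phi>] mass_shell_iff)
  with \<open>\<not> ?thesis\<close> have neg: "q t $ 0 < 0" by (simp add: mass_shell_iff q_def)
  have "isCont (\<lambda>t. q t $ 0) t" for t
    unfolding q_def matrix_vector_mult_def
    by (simp, intro continuous_sum continuous_mult continuous_const DERIV_isCont[OF DERIV_matexp])
  then have cont: "continuous_on UNIV (\<lambda>t. q t $ 0)"
    by (simp add: continuous_on_eq_continuous_at)
  have "q 0 $ 0 \<ge> 0" using p by (simp add: q_def matexp_0 mass_shell_iff)
  moreover have "connected (range (\<lambda>t. q t $ 0))"
    by (rule connected_continuous_image[OF cont connected_UNIV])
  \<comment> \<open>Intermediate values: the energy is nonnegative at parameter 0 and negative at
    \<open>t\<close>.\<close>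
  ultimately have "0 \<in> range (\<lambda>t. q t $ 0)"
    using neg connectedD_interval[of "range (\<lambda>t. q t $ 0)" "q t $ 0" "q 0 $ 0" 0] by auto
  then obtain s where s: "q s $ 0 = 0" by auto
  \<comment> \<open>At zero energy the conserved square is minus the squared spatial norm, so both
    nonnegative terms must vanish.\<close>
  have "(norm (spatial (q s)))\<^sup>2 + m\<^sup>2 = 0"
    using sq[of s] s unfolding norm_spatial mdot_coords by (simp add: power2_eq_square)
  then have "(norm (spatial (q s)))\<^sup>2 = 0" by (simp add: add_nonneg_eq_0_iff)
  then have "q s = 0"
    using s by (intro vec4_eqI) (auto simp: norm_spatial add_nonneg_eq_0_iff)
  \<comment> \<open>Undoing the transformation gives \<open>p = 0\<close>, hence zero energy also at
    \<open>t\<close>, a contradiction.\<close>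
  moreover have "p = matexp (- (s *\<^sub>R mixed \<phi>)) *v q s"
    by (simp add: q_def matrix_vector_mul_assoc matexp_minus_mult)
  ultimately have "p = 0" by simp
  with neg show False by (simp add: q_def)
qed

section \<open>The series with coefficients \<open>1/(k+1)!\<close>\<close>

lemma tilde_summable:
  "summable (\<lambda>k. (1 / fact (k + 1)) *\<^sub>R (matpow (A :: real ^ 'n ^ 'n) k *v v))"
proof -
  have "summable (\<lambda>k. (1 / fact (k + 1)) *\<^sub>R matpow A k)"
  proof (rule summable_comparison_test'[OF summable_norm_matexp[of A], where N = 0])
    fix k :: nat
    have "(1 / fact (k + 1)) * norm (matpow A k) \<le> (1 / fact k) * norm (matpow A k)"
      by (intro mult_right_mono divide_left_mono fact_mono) auto
    then show "norm ((1 / fact (k + 1)) *\<^sub>R matpow A k) \<le> norm ((1 / fact k) *\<^sub>R matpow A k)"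
      by simp
  qed
  from bounded_linear.summable[OF bounded_linear_matrix_vector this, of v] show ?thesis
    by (simp add: scaleR_matrix_vector_assoc)
qed

text \<open>This is the exponential series without its constant term, shifted by one, with one
  factor \<open>A\<close> moved onto \<open>x\<close>. It gives a closed form without inverting
  \<open>A\<close>.\<close>

lemma matexp_minus_id_sums:
  fixes A :: "real ^ 'n ^ 'n"
  shows "(\<lambda>k. (1 / fact (k + 1)) *\<^sub>R (matpow A k *v (A *v x))) sums (matexp A *v x - x)"
proof -
  have "(\<lambda>k. (1 / fact (Suc k)) *\<^sub>R (matpow A (Suc k) *v x)) sums (matexp A *v x - x)"
    using matexp_vector_sums[of A x] by (subst sums_Suc_iff) simp
  then show ?thesis by (simp add: matrix_vector_mul_assoc matpow_commute)
qed

lemma cvec_matrix_vector: "map_matrix complex_of_real A *v cvec v = cvec (A *v v)"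
  by (simp add: vec_eq_iff cvec_def map_matrix_def matrix_vector_mult_def)

lemma cvec_matpow: "matpow (map_matrix complex_of_real A) k *v cvec v = cvec (matpow A k *v v)"
  by (induction k) (simp_all add: cvec_matrix_vector flip: matrix_vector_mul_assoc)

lemma bounded_linear_cvec: "bounded_linear (cvec :: real ^ 'n \<Rightarrow> complex ^ 'n)"
  by (intro linear_conv_bounded_linear[THEN iffD1] linearI)
    (simp_all add: vec_eq_iff cvec_def scaleR_conv_of_real[where 'a = complex])

text \<open>The factor \<open>i\<close> in \<open>tilde\<close> cancels the \<open>-i\<close> in
  \<varpi>, so the series runs over powers of a real matrix and can be evaluated over the
  reals.\<close>

lemma i_scaleR_varpi:
  "map_matrix (\<lambda>z. \<i> * z) (c *\<^sub>R varpi \<phi>) = map_matrix complex_of_real (c *\<^sub>R mixed \<phi>)"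
  by (simp add: varpi_def map_matrix_def vec_eq_iff scaleR_conv_of_real[where 'a = complex]
      mult.left_commute[of "complex_of_real c" "\<i>"])

lemma tilde_cvec_sums:
  "(\<lambda>k. (1 / fact (k + 1)) *\<^sub>R (matpow (map_matrix (\<lambda>z. \<i> * z) (c *\<^sub>R varpi \<phi>)) k *v cvec v))
     sums cvec (\<Sum>k. (1 / fact (k + 1)) *\<^sub>R (matpow (c *\<^sub>R mixed \<phi>) k *v v))"
  using bounded_linear.sums[OF bounded_linear_cvec summable_sums[OF tilde_summable]]
  by (simp add: i_scaleR_varpi cvec_matpow linear_cmul[OF bounded_linear.linear[OF bounded_linear_cvec]])

lemma beta_eq: "beta \<phi> b x = cvec b + (- \<i>) *s cvec (mixed \<phi> *v x)"
  by (simp add: beta_def varpi_def vec_eq_iff cvec_def map_matrix_def matrix_vector_mult_def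
      sum_distrib_left sum_negf mult_ac)

lemma bounded_linear_vector_smult: "bounded_linear (\<lambda>v :: complex ^ 'n. c *s v)"
  by (intro linear_conv_bounded_linear[THEN iffD1] linearI)
    (simp_all add: vec_eq_iff algebra_simps)

text \<open>By linearity the \<open>x\<close>-part splits off as \<open>-i\<close> times a real
  vector; it contributes a pure phase once paired with the real momentum.\<close>

lemma tilde_beta:
  "tilde (beta \<phi> b x) (c *\<^sub>R varpi \<phi>) = tilde (cvec b) (c *\<^sub>R varpi \<phi>)
     + (- \<i>) *s cvec (\<Sum>k. (1 / fact (k + 1)) *\<^sub>R (matpow (c *\<^sub>R mixed \<phi>) k *v (mixed \<phi> *v x)))"
proof -
  define M where "M = map_matrix (\<lambda>z. \<i> * z) (c *\<^sub>R varpi \<phi>)"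
  have smult: "r *\<^sub>R (c *s v) = c *s (r *\<^sub>R v)" for r and c :: complex and v :: "complex ^ 4"
    by (simp add: vec_eq_iff)
  have "(\<lambda>k. (1 / fact (k + 1)) *\<^sub>R (matpow M k *v cvec b)
       + (- \<i>) *s ((1 / fact (k + 1)) *\<^sub>R (matpow M k *v cvec (mixed \<phi> *v x))))
     sums (tilde (cvec b) (c *\<^sub>R varpi \<phi>) + (- \<i>) *s
       cvec (\<Sum>k. (1 / fact (k + 1)) *\<^sub>R (matpow (c *\<^sub>R mixed \<phi>) k *v (mixed \<phi> *v x))))"
    using tilde_cvec_sums[of c \<phi>] unfolding M_def tilde_def
    by (intro sums_add bounded_linear.sums[OF bounded_linear_vector_smult]) (simp_all add: sums_iff)
  moreover have "(1 / fact (k + 1)) *\<^sub>R (matpow M k *v beta \<phi> b x)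
     = (1 / fact (k + 1)) *\<^sub>R (matpow M k *v cvec b)
       + (- \<i>) *s ((1 / fact (k + 1)) *\<^sub>R (matpow M k *v cvec (mixed \<phi> *v x)))" for k
    by (simp only: beta_eq matrix_vector_right_distrib vector_scalar_commute scaleR_add_right smult)
  ultimately show ?thesis
    unfolding tilde_def[of "beta \<phi> b x"] M_def by (simp only: sums_iff)
qed

section \<open>Evaluation of the individual terms\<close>

lemma mdot_add_left: "(u + v) \<bullet>\<^sub>M w = u \<bullet>\<^sub>M w + v \<bullet>\<^sub>M w"
  by (simp add: mdot_def algebra_simps sum.distrib)

lemma mdot_smult_left: "(c *s u) \<bullet>\<^sub>M w = c * (u \<bullet>\<^sub>M w)"
  by (simp add: mdot_def sum_distrib_left mult_ac)

text \<open>The \<open>b\<close>-part of the exponent is common to both sides, so only the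
  \<open>x\<close>-part has to be matched with the phase that the delta evaluates.\<close>

lemma f_c_term_eq:
  assumes \<phi>: "transpose \<phi> = - \<phi>" and p: "p \<in> mass_shell m"
  shows "f_c_term m \<phi> b \<zeta> x p n =
            exp (- of_nat n * (tilde (beta \<phi> b x) (- real n *\<^sub>R varpi \<phi>) \<bullet>\<^sub>M cvec p)
                   + of_nat n * complex_of_real \<zeta>)"
proof -
  define S where
    "S = (\<Sum>k. (1 / fact (k + 1)) *\<^sub>R (matpow (- real n *\<^sub>R mixed \<phi>) k *v (mixed \<phi> *v x)))"
  define E where "E t = matexp (t *\<^sub>R mixed \<phi>)" for t
  define T where "T = tilde (cvec b) (- real n *\<^sub>R varpi \<phi>)"
  have q: "matpow (Lorentz \<phi>) n *v p = E (real n) *v p"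
    by (simp add: Lorentz_def matpow_matexp E_def)
  have "E (real n) *v p \<in> mass_shell m"
    unfolding E_def by (rule matexp_mixed_mass_shell[OF \<phi> p])
  then have shell: "on_shell m (spatial (E (real n) *v p)) = E (real n) *v p"
    by (simp add: mass_shell_iff on_shell_spatial)
  \<comment> \<open>The prefactor \<open>- n\<close> completes the inner \<phi> to
    \<open>- n\<close> times \<phi>, the matrix of the series, as
    \<open>matexp_minus_id_sums\<close> requires.\<close>
  have "(- real n) *\<^sub>R S = E (- real n) *v x - x"
  proof -
    have "(\<lambda>k. (- real n) *\<^sub>R ((1 / fact (k + 1)) *\<^sub>R
        (matpow (- real n *\<^sub>R mixed \<phi>) k *v (mixed \<phi> *v x)))) sums ((- real n) *\<^sub>R S)"
      unfolding S_def by (intro sums_scaleR_right summable_sums tilde_summable)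
    moreover have "(- real n) *\<^sub>R ((1 / fact (k + 1)) *\<^sub>R
        (matpow (- real n *\<^sub>R mixed \<phi>) k *v (mixed \<phi> *v x)))
      = (1 / fact (k + 1)) *\<^sub>R
        (matpow (- real n *\<^sub>R mixed \<phi>) k *v ((- real n *\<^sub>R mixed \<phi>) *v x))" for k
      by (simp only: matrix_vector_mult_scaleR scaleR_scaleR mult.commute flip: scaleR_matrix_vector_assoc)
    ultimately show ?thesis
      using matexp_minus_id_sums[of "- real n *\<^sub>R mixed \<phi>" x] unfolding E_def
      by (simp only: sums_unique2)
  qed
  then have "real n *\<^sub>R S = x - E (- real n) *v x" by (simp add: algebra_simps)
  then have "(real n *\<^sub>R S) \<bullet>\<^sub>M p = (x - E (- real n) *v x) \<bullet>\<^sub>M p" by (rule arg_cong)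
  then have "real n * (S \<bullet>\<^sub>M p) = x \<bullet>\<^sub>M p - (E (- real n) *v x) \<bullet>\<^sub>M p"
    by (simp add: mdot_real inner_diff_left)
  \<comment> \<open>The exponential at \<open>- n\<close> acting on \<open>x\<close> becomes the one
    at \<open>n\<close> acting on \<open>p\<close>.\<close>
  also have "\<dots> = (p - E (real n) *v p) \<bullet>\<^sub>M x"
    unfolding E_def matexp_mixed_minus[OF \<phi>]
    by (simp add: mdot_coords algebra_simps)
  finally have phase: "(p - E (real n) *v p) \<bullet>\<^sub>M x = real n * (S \<bullet>\<^sub>M p)" ..
  have tilde: "tilde (beta \<phi> b x) (- real n *\<^sub>R varpi \<phi>) \<bullet>\<^sub>M cvec p
      = T \<bullet>\<^sub>M cvec p - \<i> * complex_of_real (S \<bullet>\<^sub>M p)"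
    unfolding tilde_beta mdot_add_left mdot_smult_left mdot_cvec S_def T_def by simp
  show ?thesis
    unfolding tilde f_c_term_def corr_term_def shell_delta_def q shell phase T_def[symmetric]
    by (simp add: algebra_simps flip: exp_add)
qed

theorem mainTheorem4:
  fixes m \<zeta> :: real and b x p :: "real ^ 4" and \<phi> :: "real ^ 4 ^ 4"
  assumes "m \<ge> 0"
    and "transpose \<phi> = - \<phi>"
    and "p \<in> mass_shell m"
  shows "(\<forall>n\<ge>1. f_c_term m \<phi> b \<zeta> x p n =
            exp (- of_nat n * (tilde (beta \<phi> b x) (- real n *\<^sub>R varpi \<phi>) \<bullet>\<^sub>M cvec p)
                   + of_nat n * complex_of_real \<zeta>))
       \<and> f_c m \<phi> b \<zeta> x p = 1 / (2 * pi) ^ 3 *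
           (\<Sum>n. exp (- of_nat (Suc n) * (tilde (beta \<phi> b x) (- real (Suc n) *\<^sub>R varpi \<phi>) \<bullet>\<^sub>M cvec p)
                   + of_nat (Suc n) * complex_of_real \<zeta>))"
  \<comment> \<open>The two series agree term by term, so their \<open>suminf\<close> values
    coincide whether or not they converge.\<close>
  unfolding f_c_def f_c_term_eq[OF assms(2,3)] by simp

end
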